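(* Let $t\ge2$. If $S\subseteq V_d$ then the following are equivalent: (i) $S$ is $t$-Ramsey; (ii) $W^*(S)$ is $t$-translate-Ramsey; (iii) $W'(S)$ is $t$-translate-Ramsey.
   Context: For $d\ge1$, $[d]=\{1,\dots,d\}$ and $V_d=2^{[d]}$ (the set of all subsets of $[d]$) is the vertex set of the $d$-dimensional hypercube $Q_d$; two sets are adjacent iff their symmetric difference has exactly one element. For $1\le d\le n$, an embedding of $Q_d$ into $Q_n$ is an injective map $\psi:V_d\to V_n$ sending adjacent pairs to adjacent pairs; an automorphism of $Q_d$ is an embedding $V_d\to V_d$. For $F\subseteq V_d$ and $T\subseteq V_n$, $T$ contains a copy of $F$ if some embedding $\psi:V_d\to V_n$ satisfies $\psi(F)\subseteq T$. A $t$-coloring of $Q_n$ is a map $c:V_n\to[t]$; it contains a monochromatic copy of $F$ if some color class $c^{-1}(i)$ contains a copy of $F$. A set $F\subseteq V_d$ is $t$-Ramsey if there is $n_0$ such that for all $n\ge n_0$ every $t$-coloring of $Q_n$ contains a monochromatic copy of $F$. For $D\subseteq\mathbb Z$ and $b\in\mathbb Z$, $D+b=\{x+b:x\in D\}$ is the translate of $D$ by $b$. A family $\mathcal D=\{D_1,\dots,D_k\}$ of sets of integers is $t$-translate-Ramsey if for every $c:\mathbb Z\to[t]$ there exist $D\in\mathcal D$ and $j\in\mathbb Z$ such that $D+j$ is monochromatic, i.e. $c$ is constant on $D+j$. For $S\subseteq V_d$, $W_d(S)=\{|A|:A\in S\}$ and $W_d^*(S)=\{W_d(\psi(S)):\psi:V_d\to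 V_d\text{ an automorphism of }Q_d\}$. $W^*(S)$ denotes $W_d^*(S)$ with $d$ minimal such that $S\subseteq V_d$. $W'(S)$ is the family of all translates of sets from $W^*(S)$ which have smallest element zero and which are minimal with respect to inclusion.
   Formalization: The equivalence with (iii) is stated only for nonempty S, since for empty S the family W'(S) is empty and (iii) fails while (i) and (ii) hold; (i)⇔(ii) is stated for every S. *)

theory Defs
  imports Main
begin

definition cube :: "nat \<Rightarrow> nat set set" where
  "cube d = Pow {1..d}"

definition adjacent :: "nat set \<Rightarrow> nat set \<Rightarrow> bool" where
  "adjacent A B \<longleftrightarrow> card ((A - B) \<union> (B - A)) = 1"

text \<open>Only the values of \<open>\<psi>\<close> on \<open>cube d\<close> matter.\<close>

definition cube_embedding :: "nat \<Rightarrow> nat \<Rightarrow> (nat set \<Rightarrow> nat set) \<Rightarrow> bool" where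
  "cube_embedding d n \<psi> \<longleftrightarrow>
     \<psi> ` cube d \<subseteq> cube n \<and> inj_on \<psi> (cube d) \<and>
     (\<forall>A\<in>cube d. \<forall>B\<in>cube d. adjacent A B \<longrightarrow> adjacent (\<psi> A) (\<psi> B))"

definition cube_automorphism :: "nat \<Rightarrow> (nat set \<Rightarrow> nat set) \<Rightarrow> bool" where
  "cube_automorphism d \<psi> \<longleftrightarrow> cube_embedding d d \<psi>"

definition contains_copy :: "nat \<Rightarrow> nat \<Rightarrow> nat set set \<Rightarrow> nat set set \<Rightarrow> bool" where
  "contains_copy d n F T \<longleftrightarrow> (\<exists>\<psi>. cube_embedding d n \<psi> \<and> \<psi> ` F \<subseteq> T)"

definition contains_mono_copy ::
  "nat \<Rightarrow> nat \<Rightarrow> nat \<Rightarrow> nat set set \<Rightarrow> (nat set \<Rightarrow> nat) \<Rightarrow> bool" where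
  "contains_mono_copy t d n F c \<longleftrightarrow>
     (\<exists>i\<in>{1..t}. contains_copy d n F {A \<in> cube n. c A = i})"

text \<open>The ambient dimension \<open>d\<close> is an explicit parameter, since copies of \<open>F\<close> are
  images under embeddings of the whole \<open>d\<close>-cube.\<close>

definition cube_ramsey :: "nat \<Rightarrow> nat \<Rightarrow> nat set set \<Rightarrow> bool" where
  "cube_ramsey t d F \<longleftrightarrow>
     (\<exists>n0. \<forall>n\<ge>n0. \<forall>c. c ` cube n \<subseteq> {1..t} \<longrightarrow> contains_mono_copy t d n F c)"

definition translate :: "int set \<Rightarrow> int \<Rightarrow> int set" where
  "translate D b = (\<lambda>x. x + b) ` D"

definition translate_ramsey :: "nat \<Rightarrow> int set set \<Rightarrow> bool" where
  "translate_ramsey t \<D> \<longleftrightarrow>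
     (\<forall>c :: int \<Rightarrow> nat. range c \<subseteq> {1..t} \<longrightarrow>
        (\<exists>D\<in>\<D>. \<exists>j. \<forall>x\<in>translate D j. \<forall>y\<in>translate D j. c x = c y))"

definition weights :: "nat set set \<Rightarrow> int set" where
  "weights S = (\<lambda>A. int (card A)) ` S"

definition W_star_dim :: "nat \<Rightarrow> nat set set \<Rightarrow> int set set" where
  "W_star_dim d S = {weights (\<psi> ` S) | \<psi>. cube_automorphism d \<psi>}"

definition min_dim :: "nat set set \<Rightarrow> nat" where
  "min_dim S = (LEAST d. 1 \<le> d \<and> S \<subseteq> cube d)"

definition W_star :: "nat set set \<Rightarrow> int set set" where
  "W_star S = W_star_dim (min_dim S) S"

definition zero_based_translates :: "int set set \<Rightarrow> int set set" where
  "zero_based_translates \<D> =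
     {translate D b | D b. D \<in> \<D> \<and> 0 \<in> translate D b \<and> (\<forall>x\<in>translate D b. 0 \<le> x)}"

text \<open>Minimality is taken among the translates with smallest element zero. The empty set
  has no smallest element, so \<open>W_prime {}\<close> is the empty family.\<close>

definition W_prime :: "nat set set \<Rightarrow> int set set" where
  "W_prime S = {D \<in> zero_based_translates (W_star S).
     \<not> (\<exists>E \<in> zero_based_translates (W_star S). E \<subset> D)}"

end

theory Submission
  imports Defs "HOL-Library.Ramsey" "HOL-Library.Diagonal_Subsequence"
begin

text \<open>
  Every embedding has the form \<open>\<psi> A = \<psi> {} \<triangle> f ` A\<close> for an injection \<open>f\<close> of the coordinates, so
  up to an additive constant the weight of \<open>\<psi> A\<close> is the weight of \<open>A \<triangle> P\<close>, where \<open>P\<close> consists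
  of the directions whose images lie in \<open>\<psi> {}\<close>. Hence a monochromatic copy for a colouring that
  depends on cardinalities only is a monochromatic translate of a member of \<open>W_star S\<close>. Conversely,
  by compactness translates inside a fixed window suffice, and by Ramsey's theorem for
  hypergraphs any colouring of a large cube depends only on the cardinality on the small subsets
  of some large set. For the family of minimal sets one uses that all the sets involved are finite.
\<close>

section \<open>Weights under embeddings\<close>

lemma adjacent_iff_insert: "adjacent A B \<longleftrightarrow> (\<exists>x. B = sym_diff A {x})"
proof
  assume "adjacent A B"
  then obtain x where "sym_diff A B = {x}"
    by (auto simp: adjacent_def card_1_singleton_iff)
  then have "B = sym_diff A {x}" by blast
  then show "\<exists>x. B = sym_diff A {x}" ..
next
  assume "\<exists>x. B = sym_diff A {x}"
  then obtain x where "B = sym_diff A {x}" ..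
  then have "sym_diff A B = {x}" by blast
  then show "adjacent A B" by (simp add: adjacent_def)
qed

lemma cube_embedding_step:
  assumes \<psi>: "cube_embedding d n \<psi>" and A: "A \<in> cube d" and i: "i \<in> {1..d}" "i \<notin> A"
  obtains x where "\<psi> (insert i A) = sym_diff (\<psi> A) {x}"
proof -
  have "insert i A \<in> cube d" using A i by (auto simp: cube_def)
  moreover have "adjacent A (insert i A)"
    unfolding adjacent_iff_insert using i by (intro exI[of _ i]) auto
  ultimately have "adjacent (\<psi> A) (\<psi> (insert i A))"
    using \<psi> A by (auto simp: cube_embedding_def)
  then show ?thesis using that by (auto simp: adjacent_iff_insert)
qed

text \<open>Two vertices at distance two have exactly two common neighbours. For \<open>Z\<close>
  with \<open>a\<close> flipped and \<open>Z\<close> with \<open>b\<close> flipped these are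
  \<open>Z\<close> itself and the opposite corner of the square, which is reached by flipping the
  other element.\<close>

lemma sym_diff_singletons_eq:
  assumes "sym_diff (sym_diff Z {a}) {u} = sym_diff (sym_diff Z {b}) {v}" "a \<noteq> b"
  shows "u = b \<or> sym_diff (sym_diff Z {a}) {u} = Z"
proof (cases "u = a")
  case True
  then show ?thesis by auto
next
  case False
  have "u = b" using assms False by (auto simp: set_eq_iff)
  then show ?thesis ..
qed

text \<open>Opposite edges of a square have images in the same direction. In the square on
  \<open>A\<close>, \<open>insert j A\<close>, \<open>insert i A\<close>,
  \<open>insert i (insert j A)\<close>, injectivity makes the two image directions at
  \<open>\<psi> A\<close> differ and keeps the image of the fourth vertex away from
  \<open>\<psi> A\<close>, so that image is the opposite corner. Induction on \<open>A\<close>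
  carries the direction \<open>f i\<close> from the edge at the empty set to the edge at
  \<open>A\<close>.\<close>

lemma cube_embedding_parallel:
  assumes \<psi>: "cube_embedding d n \<psi>"
    and f: "\<And>i. i \<in> {1..d} \<Longrightarrow> \<psi> {i} = sym_diff (\<psi> {}) {f i}"
    and A: "A \<in> cube d" and i: "i \<in> {1..d}" "i \<notin> A"
  shows "\<psi> (insert i A) = sym_diff (\<psi> A) {f i}"
proof -
  have inj: "X = Y" if "\<psi> X = \<psi> Y" "X \<in> cube d" "Y \<in> cube d" for X Y
    using \<psi> that by (auto simp: cube_embedding_def inj_on_def)
  have "finite A" using A by (auto simp: cube_def intro: finite_subset)
  then show ?thesis using A i
  proof (induction A arbitrary: i rule: finite_induct)
    case empty
    then show ?case using f by simp
  next
    case (insert j A)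
    have A: "A \<in> cube d" and j: "j \<in> {1..d}" and ij: "i \<noteq> j" "i \<notin> A"
      using insert.prems by (auto simp: cube_def)
    note ins = \<open>insert j A \<in> cube d\<close>
    have insi: "insert i A \<in> cube d" and insij: "insert i (insert j A) \<in> cube d"
      using A ins insert.prems by (auto simp: cube_def)
    have 1: "\<psi> (insert j A) = sym_diff (\<psi> A) {f j}"
      using insert.IH A j insert.hyps by blast
    have 2: "\<psi> (insert i A) = sym_diff (\<psi> A) {f i}"
      using insert.IH A insert.prems ij by blast
    have ne: "f j \<noteq> f i"
    proof
      assume "f j = f i"
      then have "insert j A = insert i A" using 1 2 by (simp add: inj[OF _ ins insi])
      then show False using ij insert.hyps by blast
    qed
    obtain u where u: "\<psi> (insert i (insert j A)) = sym_diff (\<psi> (insert j A)) {u}"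
      using cube_embedding_step[OF \<psi> ins] insert.prems by blast
    obtain v where v: "\<psi> (insert j (insert i A)) = sym_diff (\<psi> (insert i A)) {v}"
      using cube_embedding_step[OF \<psi> insi j] ij insert.hyps by blast
    have "sym_diff (sym_diff (\<psi> A) {f j}) {u} = sym_diff (sym_diff (\<psi> A) {f i}) {v}"
      using u v unfolding 1 2 by (simp only: insert_commute)
    then have "u = f i \<or> \<psi> (insert i (insert j A)) = \<psi> A"
      using sym_diff_singletons_eq[OF _ ne] u unfolding 1 by metis
    moreover have "\<psi> (insert i (insert j A)) \<noteq> \<psi> A"
      using inj[OF _ insij A] ij by blast
    ultimately show ?case using u by simp
  qed
qed

text \<open>Here \<open>f i\<close> is the direction of the image of the edge from the empty set to
  \<open>{i}\<close>. Building \<open>A\<close> one element at a time flips each \<open>f i\<close>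
  with \<open>i\<close> in \<open>A\<close> once.\<close>

lemma cube_embedding_eq:
  assumes \<psi>: "cube_embedding d n \<psi>"
  obtains f where "inj_on f {1..d}" "\<And>A. A \<in> cube d \<Longrightarrow> \<psi> A = sym_diff (\<psi> {}) (f ` A)"
proof -
  have "\<exists>x. \<psi> {i} = sym_diff (\<psi> {}) {x}" if "i \<in> {1..d}" for i
    using cube_embedding_step[OF \<psi> _ that, of "{}"] by (auto simp: cube_def)
  then obtain f where f: "\<And>i. i \<in> {1..d} \<Longrightarrow> \<psi> {i} = sym_diff (\<psi> {}) {f i}"
    by metis
  have inj: "inj_on f {1..d}"
  proof (rule inj_onI)
    fix i j assume ij: "i \<in> {1..d}" "j \<in> {1..d}" "f i = f j"
    then have "\<psi> {i} = \<psi> {j}" using f by simp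
    moreover have "inj_on \<psi> (cube d)" using \<psi> by (simp add: cube_embedding_def)
    ultimately have "{i} = {j}" using ij(1,2) by (elim inj_onD) (simp_all add: cube_def)
    then show "i = j" by simp
  qed
  have "\<psi> A = sym_diff (\<psi> {}) (f ` A)" if "A \<in> cube d" for A
  proof -
    have "finite A" using that by (auto simp: cube_def intro: finite_subset)
    then show ?thesis using that
    proof (induction A rule: finite_induct)
      case empty
      then show ?case by simp
    next
      case (insert i A)
      have A: "A \<in> cube d" and i: "i \<in> {1..d}"
        using insert.prems by (auto simp: cube_def)
      have "A \<subseteq> {1..d}" using A by (simp add: cube_def)
      \<comment> \<open>The new flip must not cancel an earlier one; this is where injectivity of
        \<open>f\<close> enters.\<close>
      then have "f i \<notin> f ` A"
        using inj_on_image_mem_iff[OF inj i] insert.hyps(2) by simp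
      moreover have "\<psi> (insert i A) = sym_diff (sym_diff (\<psi> {}) (f ` A)) {f i}"
        unfolding insert.IH[OF A, symmetric]
        by (rule cube_embedding_parallel[OF \<psi> f A i insert.hyps(2)])
      ultimately show ?case by auto
    qed
  qed
  with inj show ?thesis by (rule that)
qed

lemma card_sym_diff:
  assumes "finite A" "finite B"
  shows "int (card (sym_diff A B)) = int (card A) + int (card B) - 2 * int (card (A \<inter> B))"
proof -
  have "card (sym_diff A B) = card (A - B) + card (B - A)"
    using assms by (intro card_Un_disjoint) auto
  moreover have "card A = card (A - B) + card (A \<inter> B)" "card B = card (B - A) + card (A \<inter> B)"
    using assms by (simp_all add: card_Diff_subset_Int card_mono Int_commute)
  ultimately show ?thesis by simp
qed

lemma cube_embedding_weight:
  assumes \<psi>: "cube_embedding d n \<psi>"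
  obtains P b where "P \<subseteq> {1..d}"
    "\<And>A. A \<in> cube d \<Longrightarrow> int (card (\<psi> A)) = int (card (sym_diff A P)) + b"
proof -
  obtain f where inj: "inj_on f {1..d}"
    and f: "\<And>A. A \<in> cube d \<Longrightarrow> \<psi> A = sym_diff (\<psi> {}) (f ` A)"
    using cube_embedding_eq[OF \<psi>] by blast
  define P where "P = {i \<in> {1..d}. f i \<in> \<psi> {}}"
  have P: "P \<subseteq> {1..d}" by (auto simp: P_def)
  have "\<psi> {} \<in> cube n" using \<psi> by (auto simp: cube_embedding_def cube_def)
  then have fin: "finite (\<psi> {})" by (auto simp: cube_def intro: finite_subset)
  have "int (card (\<psi> A)) = int (card (sym_diff A P)) + (int (card (\<psi> {})) - int (card P))"
    if A: "A \<in> cube d" for A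
  proof -
    have Ad: "A \<subseteq> {1..d}" using A by (simp add: cube_def)
    then have finA: "finite A" by (rule finite_subset) simp
    have finP: "finite P" using P by (rule finite_subset) simp
    have "\<psi> {} \<inter> f ` A = f ` (A \<inter> P)" using Ad by (auto simp: P_def)
    then have "card (\<psi> {} \<inter> f ` A) = card (A \<inter> P)"
      using inj_on_subset[OF inj, of "A \<inter> P"] Ad by (simp add: card_image le_infI1)
    moreover have "card (f ` A) = card A"
      using inj_on_subset[OF inj Ad] by (rule card_image)
    ultimately show ?thesis
      using card_sym_diff[OF fin, of "f ` A"] card_sym_diff[OF finA finP] finA f[OF A] by simp
  qed
  with P show ?thesis by (rule that)
qed

section \<open>Embeddings with prescribed base set and reversed coordinates\<close>

text \<open>Flipping \<open>x\<close> in \<open>A\<close> flips exactly \<open>\<sigma> x\<close> in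
  the image, as \<open>\<sigma>\<close> is injective and \<open>B\<close> avoids its range. The base
  \<open>B\<close> serves to add a constant to all cardinalities.\<close>

lemma cube_embedding_sym_diff_image:
  assumes P: "P \<subseteq> {1..d}" and inj: "inj_on \<sigma> {1..d}" and \<sigma>: "\<sigma> ` {1..d} \<subseteq> {1..n}"
    and B: "B \<subseteq> {1..n}" "B \<inter> \<sigma> ` {1..d} = {}"
  shows "cube_embedding d n (\<lambda>A. B \<union> \<sigma> ` sym_diff A P)"
  unfolding cube_embedding_def
proof (intro conjI ballI impI)
  show "(\<lambda>A. B \<union> \<sigma> ` sym_diff A P) ` cube d \<subseteq> cube n"
  proof (rule image_subsetI)
    fix A assume "A \<in> cube d"
    then have "sym_diff A P \<subseteq> {1..d}" using P by (auto simp: cube_def)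
    then have "\<sigma> ` sym_diff A P \<subseteq> {1..n}" using \<sigma> by (meson image_mono subset_trans)
    then show "B \<union> \<sigma> ` sym_diff A P \<in> cube n" using B(1) by (simp add: cube_def)
  qed
  show "inj_on (\<lambda>A. B \<union> \<sigma> ` sym_diff A P) (cube d)"
  proof (rule inj_onI)
    fix A A' assume A: "A \<in> cube d" "A' \<in> cube d"
      and eq: "B \<union> \<sigma> ` sym_diff A P = B \<union> \<sigma> ` sym_diff A' P"
    have sub: "sym_diff A P \<subseteq> {1..d}" "sym_diff A' P \<subseteq> {1..d}"
      using A P by (auto simp: cube_def)
    then have "\<sigma> ` sym_diff A P = \<sigma> ` sym_diff A' P"
      using eq B by blast
    then have "sym_diff A P = sym_diff A' P"
      using inj_on_image_eq_iff[OF inj sub] by blast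
    then show "A = A'" by blast
  qed
  fix A A' assume A: "A \<in> cube d" "A' \<in> cube d" and adj: "adjacent A A'"
  obtain x where x: "A' = sym_diff A {x}" using adj by (auto simp: adjacent_iff_insert)
  have "x \<in> A \<union> A'" using x by blast
  then have xd: "x \<in> {1..d}" using A by (auto simp: cube_def)
  have sub: "sym_diff A P \<subseteq> {1..d}" using A P by (auto simp: cube_def)
  define Y where "Y = sym_diff A P"
  have "sym_diff A' P = sym_diff Y {x}" unfolding x Y_def by blast
  moreover have "Y \<subseteq> {1..d}" "{x} \<subseteq> {1..d}" using sub xd by (simp_all add: Y_def)
  then have "\<sigma> ` (Y - {x}) = \<sigma> ` Y - \<sigma> ` {x}" "\<sigma> ` ({x} - Y) = \<sigma> ` {x} - \<sigma> ` Y"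
    by (meson inj_on_image_set_diff[OF inj] Diff_subset subset_trans)+
  ultimately have "\<sigma> ` sym_diff A' P = sym_diff (\<sigma> ` sym_diff A P) {\<sigma> x}"
    by (simp add: image_Un flip: Y_def)
  moreover have "\<sigma> x \<notin> B" using B xd by blast
  ultimately have "B \<union> \<sigma> ` sym_diff A' P = sym_diff (B \<union> \<sigma> ` sym_diff A P) {\<sigma> x}"
    by auto
  then show "adjacent (B \<union> \<sigma> ` sym_diff A P) (B \<union> \<sigma> ` sym_diff A' P)"
    unfolding adjacent_iff_insert by blast
qed

text \<open>Reflections are the only automorphisms needed for weights, since permuting coordinates
  leaves cardinalities unchanged.\<close>

lemma cube_automorphism_sym_diff:
  assumes "P \<subseteq> {1..d}"
  shows "cube_automorphism d (\<lambda>A. sym_diff A P)"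
  using cube_embedding_sym_diff_image[OF assms, of id d "{}"] by (simp add: cube_automorphism_def)

section \<open>Passing between the minimal and the ambient dimension\<close>

lemma min_dim:
  assumes "1 \<le> d" "S \<subseteq> cube d"
  shows "S \<subseteq> cube (min_dim S)" "min_dim S \<le> d"
  using LeastI[of "\<lambda>d. 1 \<le> d \<and> S \<subseteq> cube d" d] Least_le[of "\<lambda>d. 1 \<le> d \<and> S \<subseteq> cube d" d] assms
  by (auto simp: min_dim_def)

lemma W_starE:
  assumes D: "D \<in> W_star S" and S: "1 \<le> d" "S \<subseteq> cube d"
  obtains P b where "P \<subseteq> {1..d}" "D = (\<lambda>A. int (card (sym_diff A P)) + b) ` S"
proof -
  let ?m = "min_dim S"
  note m = min_dim[OF S]
  obtain \<phi> where \<phi>: "cube_automorphism ?m \<phi>" and D': "D = weights (\<phi> ` S)"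
    using D by (auto simp: W_star_def W_star_dim_def)
  obtain P b where P: "P \<subseteq> {1..?m}"
    and w: "\<And>A. A \<in> cube ?m \<Longrightarrow> int (card (\<phi> A)) = int (card (sym_diff A P)) + b"
    using \<phi> cube_embedding_weight unfolding cube_automorphism_def by metis
  have "D = (\<lambda>A. int (card (\<phi> A))) ` S" by (simp add: D' weights_def image_image)
  also have "\<dots> = (\<lambda>A. int (card (sym_diff A P)) + b) ` S"
    using m by (intro image_cong refl w) auto
  finally have D_eq: "D = (\<lambda>A. int (card (sym_diff A P)) + b) ` S" .
  have "P \<subseteq> {1..d}" using P m(2) by auto
  then show ?thesis using D_eq by (rule that)
qed

text \<open>Coordinates of \<open>P\<close> beyond the minimal dimension occur in no member of
  \<open>S\<close>, so they add the same number to every weight. Discarding them changes the weight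
  set by a translation.\<close>

lemma W_starI:
  assumes P: "P \<subseteq> {1..d}" and S: "1 \<le> d" "S \<subseteq> cube d"
  obtains D b where "D \<in> W_star S" "(\<lambda>A. int (card (sym_diff A P))) ` S = translate D b"
proof -
  let ?m = "min_dim S"
  let ?P = "P \<inter> {1..?m}"
  note m = min_dim[OF S]
  have finP: "finite P" using P by (rule finite_subset) simp
  have "weights ((\<lambda>A. sym_diff A ?P) ` S) \<in> W_star S"
    unfolding W_star_def W_star_dim_def
    using cube_automorphism_sym_diff[of ?P ?m] by blast
  moreover have "int (card (sym_diff A P)) = int (card (sym_diff A ?P)) + int (card (P - {1..?m}))"
    if "A \<in> S" for A
  proof -
    have A: "A \<subseteq> {1..?m}" using that m by (auto simp: cube_def)
    then have "sym_diff A P = sym_diff A ?P \<union> (P - {1..?m})" by auto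
    moreover have "card \<dots> = card (sym_diff A ?P) + card (P - {1..?m})"
      using finP A by (intro card_Un_disjoint) (auto intro: finite_subset)
    ultimately show ?thesis by simp
  qed
  then have "(\<lambda>A. int (card (sym_diff A P))) ` S
      = translate (weights ((\<lambda>A. sym_diff A ?P) ` S)) (int (card (P - {1..?m})))"
    by (simp add: translate_def weights_def image_image cong: image_cong)
  ultimately show ?thesis using that by blast
qed

lemma translate_translate: "translate (translate D a) b = translate D (a + b)"
  by (simp add: translate_def image_image add.assoc)

lemma cube_ramsey_imp_translate_ramsey:
  assumes S: "1 \<le> d" "S \<subseteq> cube d" and ramsey: "cube_ramsey t d S"
  shows "translate_ramsey t (W_star S)"
  unfolding translate_ramsey_def
proof (intro allI impI)
  fix c :: "int \<Rightarrow> nat" assume c: "range c \<subseteq> {1..t}"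
  obtain n where n: "\<And>c. c ` cube n \<subseteq> {1..t} \<Longrightarrow> contains_mono_copy t d n S c"
    using ramsey unfolding cube_ramsey_def by (meson order_refl)
  have "contains_mono_copy t d n S (\<lambda>A. c (int (card A)))"
    using c by (intro n) auto
  then obtain i where "contains_copy d n S {A \<in> cube n. c (int (card A)) = i}"
    unfolding contains_mono_copy_def by blast
  then obtain \<psi> where \<psi>: "cube_embedding d n \<psi>"
    and "\<psi> ` S \<subseteq> {A \<in> cube n. c (int (card A)) = i}"
    unfolding contains_copy_def by blast
  then have mono: "c (int (card (\<psi> A))) = i" if "A \<in> S" for A using that by blast
  obtain P b where P: "P \<subseteq> {1..d}"
    and w: "\<And>A. A \<in> cube d \<Longrightarrow> int (card (\<psi> A)) = int (card (sym_diff A P)) + b"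
    using cube_embedding_weight[OF \<psi>] by metis
  obtain D a where D: "D \<in> W_star S" "(\<lambda>A. int (card (sym_diff A P))) ` S = translate D a"
    using W_starI[OF P S] by metis
  \<comment> \<open>Two shifts combine: \<open>a\<close> comes from passing to the minimal
    dimension, \<open>b\<close> from the embedding \<open>\<psi>\<close>.\<close>
  have "translate D (a + b) = translate ((\<lambda>A. int (card (sym_diff A P))) ` S) b"
    by (simp add: D translate_translate)
  also have "\<dots> = (\<lambda>A. int (card (\<psi> A))) ` S"
    unfolding translate_def image_image using S by (intro image_cong refl w[symmetric]) auto
  finally have image: "translate D (a + b) = (\<lambda>A. int (card (\<psi> A))) ` S" .
  have "c x = i" if x: "x \<in> translate D (a + b)" for x
  proof -
    obtain A where "x = int (card (\<psi> A))" "A \<in> S" using x unfolding image by (rule imageE)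
    then show ?thesis using mono by simp
  qed
  then have mono: "\<forall>x\<in>translate D (a + b). \<forall>y\<in>translate D (a + b). c x = c y"
    by simp
  show "\<exists>D\<in>W_star S. \<exists>j. \<forall>x\<in>translate D j. \<forall>y\<in>translate D j. c x = c y"
    by (rule bexI[where x = D], rule exI[where x = "a + b"], rule mono, rule D)
qed

section \<open>Compactness and Ramsey's theorem\<close>

lemma constant_on_subsequence:
  fixes g :: "nat \<Rightarrow> 'a"
  assumes "finite (range g)"
  obtains r :: "nat \<Rightarrow> nat" and a where "strict_mono r" "\<And>k. g (r k) = a"
proof -
  obtain n0 where inf: "infinite {n \<in> UNIV. g n = g n0}"
    using pigeonhole_infinite[OF infinite_UNIV_nat assms] by blast
  let ?r = "enumerate {n \<in> UNIV. g n = g n0}"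
  have "strict_mono ?r" using strict_mono_enumerate[OF inf] .
  moreover have "g (?r k) = g n0" for k using enumerate_in_set[OF inf, of k] by simp
  ultimately show ?thesis using that by blast
qed

text \<open>A diagonal argument over an enumeration of the points: \<open>Q m s\<close> says that
  the colourings along \<open>s\<close> agree at the point with code \<open>m\<close>. The diagonal
  sequence satisfies this from index \<open>Suc m\<close> on, and \<open>c'\<close> is the resulting
  pointwise limit.\<close>

lemma colouring_compactness:
  fixes c :: "nat \<Rightarrow> 'a :: countable \<Rightarrow> 'b"
  assumes K: "finite K" "\<And>n x. c n x \<in> K"
  obtains c' where "\<And>x. c' x \<in> K"
    "\<And>X n0. finite X \<Longrightarrow> \<exists>n\<ge>n0. \<forall>x\<in>X. c n x = c' x"
proof -
  define Q :: "nat \<Rightarrow> (nat \<Rightarrow> nat) \<Rightarrow> bool"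
    where "Q m s \<longleftrightarrow> (\<exists>a. \<forall>k. c (s k) (from_nat m) = a)" for m s
  interpret subseqs Q
  proof
    fix m and s :: "nat \<Rightarrow> nat" assume "strict_mono s"
    have "finite (range (\<lambda>k. c (s k) (from_nat m)))"
      using K by (auto intro: finite_subset)
    then obtain r :: "nat \<Rightarrow> nat" and a
      where "strict_mono r" "\<And>k. c (s (r k)) (from_nat m) = a"
      by (rule constant_on_subsequence[where g = "\<lambda>k. c (s k) (from_nat m)"]) blast
    then show "\<exists>r. strict_mono r \<and> Q m (s \<circ> r)" by (auto simp: Q_def)
  qed
  have Q: "Q m (diagseq \<circ> (+) (Suc m))" for m
    by (rule diagseq_holds) (auto simp: Q_def)
  have "\<exists>a. \<forall>k. c (diagseq (Suc (to_nat x) + k)) x = a" for x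
    using Q[of "to_nat x"] by (simp add: Q_def)
  then obtain c' where "\<forall>x k. c (diagseq (Suc (to_nat x) + k)) x = c' x"
    using choice[of "\<lambda>x a. \<forall>k. c (diagseq (Suc (to_nat x) + k)) x = a"] by blast
  then have c': "c (diagseq (Suc (to_nat x) + k)) x = c' x" for x k by blast
  have ev: "c (diagseq k) x = c' x" if "k \<ge> Suc (to_nat x)" for x k
    using c'[of x "k - Suc (to_nat x)"] that by simp
  have "\<exists>n\<ge>n0. \<forall>x\<in>X. c n x = c' x" if X: "finite X" for X n0
  proof -
    obtain M where M: "\<And>x. x \<in> X \<Longrightarrow> to_nat x \<le> M"
      using finite_imageI[OF X, of to_nat] by (auto simp: finite_nat_set_iff_bounded_le)
    \<comment> \<open>This index lies past the stage at which every point of \<open>X\<close> has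
      settled, and \<open>diagseq k\<close> is at least \<open>k\<close>.\<close>
    have "diagseq (max n0 (Suc M)) \<ge> n0"
      using seq_suble[OF subseq_diagseq, of "max n0 (Suc M)"] by simp
    moreover have "\<forall>x\<in>X. c (diagseq (max n0 (Suc M))) x = c' x"
      using M by (intro ballI ev) (simp add: le_max_iff_disj)
    ultimately show ?thesis by blast
  qed
  moreover have "c' x \<in> K" for x using K(2) c'[of x 0] by metis
  ultimately show ?thesis using that by blast
qed

lemma translate_ramsey_window:
  assumes ramsey: "translate_ramsey t \<D>" and fin: "\<And>D. D \<in> \<D> \<Longrightarrow> finite D"
  shows "\<exists>N :: nat. \<forall>c. range c \<subseteq> {1..t} \<longrightarrow>
    (\<exists>D\<in>\<D>. \<exists>j. translate D j \<subseteq> {- int N..int N} \<and>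
       (\<forall>x\<in>translate D j. \<forall>y\<in>translate D j. c x = c y))"
proof -
  define good :: "(int \<Rightarrow> nat) \<Rightarrow> nat \<Rightarrow> bool"
    where "good c N \<longleftrightarrow> (\<exists>D\<in>\<D>. \<exists>j. translate D j \<subseteq> {- int N..int N} \<and>
       (\<forall>x\<in>translate D j. \<forall>y\<in>translate D j. c x = c y))" for c N
  have "\<exists>N. \<forall>c. range c \<subseteq> {1..t} \<longrightarrow> good c N"
  proof (rule ccontr)
    assume "\<not> (\<exists>N. \<forall>c. range c \<subseteq> {1..t} \<longrightarrow> good c N)"
    then have "\<forall>N. \<exists>c. range c \<subseteq> {1..t} \<and> \<not> good c N" by blast
    then obtain c :: "nat \<Rightarrow> int \<Rightarrow> nat"
      where c: "\<And>N. range (c N) \<subseteq> {1..t}" and bad: "\<And>N. \<not> good (c N) N"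
      by metis
    have ct: "c N x \<in> {1..t}" for N x using c[of N] by blast
    obtain c' where c': "\<And>x. c' x \<in> {1..t}"
      and approx: "\<And>X n0. finite X \<Longrightarrow> \<exists>n\<ge>n0. \<forall>x\<in>X. c n x = c' x"
      using colouring_compactness[of "{1..t}" c, OF _ ct] by (metis finite_atLeastAtMost)
    have "range c' \<subseteq> {1..t}" using c' by blast
    then obtain D j where D: "D \<in> \<D>"
      and mono: "\<forall>x\<in>translate D j. \<forall>y\<in>translate D j. c' x = c' y"
      using ramsey unfolding translate_ramsey_def by metis
    have finD: "finite (translate D j)" using fin[OF D] by (simp add: translate_def)
    obtain M where M: "\<And>x. x \<in> translate D j \<Longrightarrow> nat \<bar>x\<bar> \<le> M"
      using finite_imageI[OF finD, of "\<lambda>x. nat \<bar>x\<bar>"] by (auto simp: finite_nat_set_iff_bounded_le)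
    \<comment> \<open>The bound \<open>N \<ge> M\<close> makes the translate fit into the window
      belonging to the same index \<open>N\<close>.\<close>
    obtain N where N: "N \<ge> M" "\<forall>x\<in>translate D j. c N x = c' x"
      using approx[OF finD] by blast
    have "translate D j \<subseteq> {- int N..int N}"
      using M N(1) by fastforce
    then have "good (c N) N" using D mono N(2) unfolding good_def by metis
    then show False using bad by blast
  qed
  then show ?thesis unfolding good_def .
qed

section \<open>Sets homogeneous for all small cardinalities\<close>

definition homogeneous :: "('a set \<Rightarrow> 'b) \<Rightarrow> nat \<Rightarrow> 'a set \<Rightarrow> bool" where
  "homogeneous c k M \<longleftrightarrow> (\<exists>i. \<forall>A\<subseteq>M. card A = k \<longrightarrow> c A = i)"

lemma homogeneous_subset: "homogeneous c k M \<Longrightarrow> M' \<subseteq> M \<Longrightarrow> homogeneous c k M'"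
  unfolding homogeneous_def by (meson subset_trans)

lemma homogeneousD:
  "homogeneous c k M \<Longrightarrow> A \<subseteq> M \<Longrightarrow> B \<subseteq> M \<Longrightarrow> card A = k \<Longrightarrow> card B = k \<Longrightarrow> c A = c B"
  unfolding homogeneous_def by metis

text \<open>The hypergraph Ramsey theorem with the same target size \<open>L\<close> for each of the
  \<open>t\<close> colours, transported from \<open>{..<N}\<close> to \<open>X\<close> along a
  bijection.\<close>

lemma ramsey_card:
  fixes t k L :: nat
  shows "\<exists>N. \<forall>X (c :: 'a set \<Rightarrow> nat). finite X \<longrightarrow> card X = N \<longrightarrow> c ` Pow X \<subseteq> {1..t} \<longrightarrow>
    (\<exists>M\<subseteq>X. card M = L \<and> homogeneous c k M)"
proof -
  obtain N :: nat where N: "partn_lst {..<N} (replicate t L) k"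
    using ramsey_full ..
  have "\<exists>M\<subseteq>X. card M = L \<and> homogeneous c k M"
    if X: "finite X" "card X = N" and c: "c ` Pow X \<subseteq> {1..t}"
    for X and c :: "'a set \<Rightarrow> nat"
  proof -
    have ct: "c A \<in> {1..t}" if "A \<subseteq> X" for A using c that by blast
    obtain h where h: "bij_betw h {..<N} X"
      using ex_bij_betw_nat_finite[OF X(1)] X(2) by (auto simp: atLeast0LessThan)
    have hX: "h ` A \<subseteq> X" if "A \<subseteq> {..<N}" for A using that h by (auto simp: bij_betw_def)
    \<comment> \<open>\<open>partn_lst\<close> numbers colours from 0, so the colours are lowered by
      one.\<close>
    have "(\<lambda>A. c (h ` A) - 1) \<in> nsets {..<N} k \<rightarrow> {..<t}"
    proof
      fix A assume "A \<in> nsets {..<N} k"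
      then have "h ` A \<subseteq> X" by (intro hX) (simp add: nsets_def)
      then have "c (h ` A) \<in> {1..t}" by (rule ct)
      then show "c (h ` A) - 1 \<in> {..<t}" by auto
    qed
    then obtain i H where H: "H \<in> nsets {..<N} (replicate t L ! i)" and i: "i < t"
      and mono: "(\<lambda>A. c (h ` A) - 1) ` nsets H k \<subseteq> {i}"
      using partn_lstE[OF N, of _ t] by (metis length_replicate)
    have HN: "H \<subseteq> {..<N}" and cardH: "card H = L" and finH: "finite H"
      using H i by (auto simp: nsets_def)
    have inj: "inj_on h H" using h HN by (auto simp: bij_betw_def intro: inj_on_subset)
    have "c A = Suc i" if A: "A \<subseteq> h ` H" "card A = k" for A
    proof -
      obtain A' where A': "A' \<subseteq> H" "A = h ` A'" using A(1) by (auto simp: subset_image_iff)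
      have "card A' = k"
        using A A' card_image[OF inj_on_subset[OF inj A'(1)]] by simp
      then have "A' \<in> nsets H k" using A' finH by (auto simp: nsets_def intro: finite_subset)
      then have "c A - 1 = i" using mono A' by blast
      \<comment> \<open>Truncated subtraction is undone only because \<open>c A\<close> is at least
        1.\<close>
      moreover have "c A \<in> {1..t}" using A(1) hX[OF HN] by (intro ct) (rule subset_trans)
      ultimately show ?thesis by auto
    qed
    then have "homogeneous c k (h ` H)" unfolding homogeneous_def by blast
    moreover have "card (h ` H) = L" using card_image[OF inj] cardH by simp
    ultimately show ?thesis using hX[OF HN] by metis
  qed
  then show ?thesis by (intro exI[of _ N]) simp
qed

text \<open>Sizes are treated one after another, homogeneity being inherited by subsets. The number
  \<open>N\<close> required for size \<open>K\<close> is chosen first and then becomes the target of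
  the induction hypothesis, hence the generalisation over \<open>L\<close>.\<close>

lemma ramsey_card_upto:
  fixes t K L :: nat
  shows "\<exists>N. \<forall>X (c :: 'a set \<Rightarrow> nat). finite X \<longrightarrow> N \<le> card X \<longrightarrow> c ` Pow X \<subseteq> {1..t} \<longrightarrow>
    (\<exists>M\<subseteq>X. card M = L \<and> (\<forall>k<K. homogeneous c k M))"
proof (induction K arbitrary: L)
  case 0
  show ?case
    by (intro exI[of _ L]) (metis obtain_subset_with_card_n not_less0)
next
  case (Suc K)
  obtain N where N: "\<forall>X (c :: 'a set \<Rightarrow> nat). finite X \<longrightarrow> card X = N \<longrightarrow> c ` Pow X \<subseteq> {1..t} \<longrightarrow>
    (\<exists>M\<subseteq>X. card M = L \<and> homogeneous c K M)"
    using ramsey_card ..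
  obtain N' where N': "\<forall>X (c :: 'a set \<Rightarrow> nat). finite X \<longrightarrow> N' \<le> card X \<longrightarrow> c ` Pow X \<subseteq> {1..t} \<longrightarrow>
    (\<exists>M\<subseteq>X. card M = N \<and> (\<forall>k<K. homogeneous c k M))"
    using Suc.IH ..
  show ?case
  proof (intro exI[of _ N'] allI impI)
    fix X and c :: "'a set \<Rightarrow> nat"
    assume X: "finite X" "N' \<le> card X" and c: "c ` Pow X \<subseteq> {1..t}"
    obtain Y where Y: "Y \<subseteq> X" "card Y = N" and low: "\<forall>k<K. homogeneous c k Y"
      using N' X c by metis
    have "finite Y" using Y X by (auto intro: finite_subset)
    moreover have "c ` Pow Y \<subseteq> {1..t}" using c Y(1) by blast
    ultimately obtain M where M: "M \<subseteq> Y" "card M = L" and top: "homogeneous c K M"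
      using N Y(2) by metis
    have "\<forall>k<Suc K. homogeneous c k M"
      using low top M(1) by (metis homogeneous_subset less_SucE)
    then show "\<exists>M\<subseteq>X. card M = L \<and> (\<forall>k<Suc K. homogeneous c k M)"
      using M Y(1) by (metis subset_trans)
  qed
qed

section \<open>Monochromatic copies from monochromatic translates\<close>

lemma finite_cube: "finite (cube d)"
  by (simp add: cube_def)

lemma finite_W_star_member:
  assumes "1 \<le> d" "S \<subseteq> cube d" "D \<in> W_star S"
  shows "finite D"
  using assms finite_subset[OF assms(2) finite_cube]
  by (auto simp: W_star_def W_star_dim_def weights_def)

lemma W_star_nonempty_member: "S \<noteq> {} \<Longrightarrow> D \<in> W_star S \<Longrightarrow> D \<noteq> {}"
  by (auto simp: W_star_def W_star_dim_def weights_def)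

text \<open>With no vertex to be coloured, any embedding and any colour will do; the threshold
  \<open>d\<close> ensures that an embedding exists.\<close>

lemma cube_ramsey_empty:
  assumes "1 \<le> t"
  shows "cube_ramsey t d {}"
  unfolding cube_ramsey_def
proof (intro exI[of _ d] allI impI)
  fix n :: nat and c :: "nat set \<Rightarrow> nat" assume "d \<le> n"
  then have "cube_embedding d n (\<lambda>A. A)"
    using cube_embedding_sym_diff_image[of "{}" d id n "{}"] by auto
  then show "contains_mono_copy t d n {} c"
    using assms by (auto simp: contains_mono_copy_def contains_copy_def)
qed

text \<open>On a large set \<open>M\<close> the colour of a small subset depends on its size alone,
  which yields a colouring \<open>e\<close> of sizes and hence of the window. A monochromatic
  \<open>translate D j\<close> is realised inside \<open>M\<close>: \<open>P\<close> tells which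
  coordinates to reverse, and the shifts determine the size \<open>q\<close> of the base
  set.\<close>

lemma translate_ramsey_imp_cube_ramsey:
  assumes t: "1 \<le> t" and S: "1 \<le> d" "S \<subseteq> cube d" and ramsey: "translate_ramsey t (W_star S)"
  shows "cube_ramsey t d S"
proof (cases "S = {}")
  case True
  then show ?thesis using cube_ramsey_empty[OF t] by simp
next
  case False
  obtain N :: nat where N: "\<forall>c. range c \<subseteq> {1..t} \<longrightarrow>
      (\<exists>D\<in>W_star S. \<exists>j. translate D j \<subseteq> {- int N..int N} \<and>
        (\<forall>x\<in>translate D j. \<forall>y\<in>translate D j. c x = c y))"
    using translate_ramsey_window[OF ramsey finite_W_star_member[OF S]] ..
  \<comment> \<open>The window is moved by \<open>N + d\<close> so that the base set \<open>B\<close> below has nonnegative cardinality: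
    the smallest element of a translate may exceed the translation distance by up to \<open>d\<close>.\<close>
  define K where "K = 2 * N + d"
  \<comment> \<open>Of the \<open>K + d\<close> elements, \<open>d\<close> will serve as directions,
    leaving \<open>K\<close> for the base set. Homogeneity is needed for the sizes 0 to
    \<open>K\<close>.\<close>
  obtain n0 where n0: "\<forall>X (c :: nat set \<Rightarrow> nat). finite X \<longrightarrow> n0 \<le> card X \<longrightarrow>
      c ` Pow X \<subseteq> {1..t} \<longrightarrow> (\<exists>M\<subseteq>X. card M = K + d \<and> (\<forall>k<Suc K. homogeneous c k M))"
    using ramsey_card_upto ..
  show ?thesis unfolding cube_ramsey_def
  proof (intro exI[of _ n0] allI impI)
    fix n c assume n: "n0 \<le> n" and c: "c ` cube n \<subseteq> {1..t}"
    obtain M where M: "M \<subseteq> {1..n}" "card M = K + d"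
      and hom: "\<forall>k<Suc K. homogeneous c k M"
      using n0[THEN spec, THEN spec, of "{1..n}" c] n c by (auto simp: cube_def)
    have finM: "finite M" using M(1) by (rule finite_subset) simp
    \<comment> \<open>Sizes are cut off at \<open>K\<close> so that \<open>e\<close> takes a value
      in \<open>{1..t}\<close> at every argument, as a colouring of all integers requires.\<close>
    have "\<exists>A. A \<subseteq> M \<and> card A = min K k" for k
      using obtain_subset_with_card_n[of "min K k" M] M(2) by (metis min.cobounded1 trans_le_add1)
    then obtain R where R: "\<And>k. R k \<subseteq> M" "\<And>k. card (R k) = min K k"
      by metis
    define e where "e k = c (R k)" for k
    have e: "c A = e (card A)" if "A \<subseteq> M" "card A \<le> K" for A
    proof -
      have "homogeneous c (card A) M" using hom that(2) by simp
      then show ?thesis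
        unfolding e_def using that R by (intro homogeneousD) simp_all
    qed
    have e_range: "e k \<in> {1..t}" for k
    proof -
      have "R k \<in> cube n"
        using R(1)[of k] M(1) unfolding cube_def by (metis PowI subset_trans)
      then show ?thesis unfolding e_def using c by blast
    qed
    obtain D j where D: "D \<in> W_star S" "translate D j \<subseteq> {- int N..int N}"
      and mono: "\<forall>x\<in>translate D j. \<forall>y\<in>translate D j.
        e (nat (x + int N + int d)) = e (nat (y + int N + int d))"
      using N[THEN spec, of "\<lambda>x. e (nat (x + int N + int d))"] e_range by blast
    obtain P b where P: "P \<subseteq> {1..d}" and D': "D = (\<lambda>A. int (card (sym_diff A P)) + b) ` S"
      using W_starE[OF D(1) S] by metis
    have card_le: "card (sym_diff A P) \<le> d" if "A \<in> S" for A
      using card_mono[of "{1..d}" "sym_diff A P"] that S P by (auto simp: cube_def)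
    define q where "q = nat (b + j + int N + int d)"
    have tr: "int (card (sym_diff A P)) + b + j \<in> translate D j" if "A \<in> S" for A
      using that by (auto simp: D' translate_def)
    \<comment> \<open>A member of \<open>S\<close> is needed to see that \<open>q\<close> is not
      truncated: its weight is at most \<open>d\<close> and its point of the translate is at least
      \<open>- int N\<close>, so \<open>b + j + int N + int d\<close> is nonnegative.\<close>
    obtain A0 where A0: "A0 \<in> S" using False by blast
    have q: "int q = b + j + int N + int d"
      using tr[OF A0] D(2) card_le[OF A0] unfolding q_def by fastforce
    \<comment> \<open>The point \<open>x\<close> of the translate corresponds to the size
      \<open>x + int N + int d\<close>, at most \<open>2 * N + d\<close>.\<close>
    have size_le: "q + card (sym_diff A P) \<le> K" if "A \<in> S" for A
      using tr[OF that] D(2) q unfolding K_def by fastforce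
    obtain M1 where M1: "M1 \<subseteq> M" "card M1 = d" "finite M1"
      using obtain_subset_with_card_n[of d M] M(2) by auto
    have "q \<le> card (M - M1)"
      using size_le[OF A0] M M1 by (simp add: card_Diff_subset)
    then obtain B where B: "B \<subseteq> M - M1" "card B = q" "finite B"
      using obtain_subset_with_card_n by metis
    obtain \<sigma> where \<sigma>: "bij_betw \<sigma> {1..d} M1"
      using finite_same_card_bij[of "{1..d}" M1] M1 by auto
    let ?\<psi> = "\<lambda>A. B \<union> \<sigma> ` sym_diff A P"
    have emb: "cube_embedding d n ?\<psi>"
      using P \<sigma> B M1 M by (intro cube_embedding_sym_diff_image) (auto simp: bij_betw_def)
    have val: "c (?\<psi> A) = e (nat (int (card (sym_diff A P)) + b + j + int N + int d))"
      if A: "A \<in> S" for A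
    proof -
      have sub: "sym_diff A P \<subseteq> {1..d}" using A S P by (auto simp: cube_def)
      then have M1': "\<sigma> ` sym_diff A P \<subseteq> M1" using \<sigma> by (auto simp: bij_betw_def)
      have "card (\<sigma> ` sym_diff A P) = card (sym_diff A P)"
        using \<sigma> sub by (intro card_image) (auto simp: bij_betw_def intro: inj_on_subset)
      moreover have "finite (\<sigma> ` sym_diff A P)" using sub by (auto intro: finite_subset)
      moreover have "B \<inter> \<sigma> ` sym_diff A P = {}" using B(1) M1' by blast
      ultimately have "card (?\<psi> A) = q + card (sym_diff A P)"
        using card_Un_disjoint[OF B(3)] B(2) by simp
      moreover have "?\<psi> A \<subseteq> M" using B(1) M1' M1(1) by blast
      moreover have "q + card (sym_diff A P)
          = nat (int (card (sym_diff A P)) + b + j + int N + int d)"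
        using q by linarith
      ultimately show ?thesis using e[of "?\<psi> A"] size_le[OF A] by simp
    qed
    have "c (?\<psi> A) = c (?\<psi> A0)" if "A \<in> S" for A
      unfolding val[OF that] val[OF A0] using mono tr[OF that] tr[OF A0] by blast
    moreover have in_cube: "?\<psi> A \<in> cube n" if "A \<in> S" for A
      using emb S that by (auto simp: cube_embedding_def)
    ultimately have "?\<psi> ` S \<subseteq> {A \<in> cube n. c A = c (?\<psi> A0)}" by blast
    with emb have "contains_copy d n S {A \<in> cube n. c A = c (?\<psi> A0)}"
      unfolding contains_copy_def by (intro exI[of _ ?\<psi>] conjI)
    moreover have "c (?\<psi> A0) \<in> {1..t}" using c in_cube[OF A0] by blast
    ultimately show "contains_mono_copy t d n S c"
      unfolding contains_mono_copy_def by (rule bexI[where x = "c (?\<psi> A0)"])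
  qed
qed

section \<open>Minimal zero-based translates\<close>

lemma zero_based_translatesI:
  "D \<in> \<D> \<Longrightarrow> 0 \<in> translate D b \<Longrightarrow> \<forall>x\<in>translate D b. 0 \<le> x \<Longrightarrow>
    translate D b \<in> zero_based_translates \<D>"
  unfolding zero_based_translates_def by blast

text \<open>Subtracting the minimum makes \<open>D\<close> zero-based. Among the finitely many
  zero-based translates contained in the result there is an inclusion-minimal one; it is minimal in
  the whole family, because anything strictly below it is again contained in that result.\<close>

lemma W_prime_below:
  assumes fin: "\<And>D. D \<in> W_star S \<Longrightarrow> finite D" and D: "D \<in> W_star S" "D \<noteq> {}"
  obtains E b where "E \<in> W_prime S" "E \<subseteq> translate D b"
proof -
  let ?Z = "zero_based_translates (W_star S)"
  have zero: "translate D (- Min D) \<in> ?Z"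
  proof (rule zero_based_translatesI)
    show "D \<in> W_star S" by (rule D)
    show "0 \<in> translate D (- Min D)"
      unfolding translate_def
      by (rule image_eqI[of _ _ "Min D"]) (simp_all add: Min_in[OF fin[OF D(1)] D(2)])
    show "\<forall>x\<in>translate D (- Min D). 0 \<le> x"
      using fin[OF D(1)] by (simp add: translate_def)
  qed
  define F where "F = {E \<in> ?Z. E \<subseteq> translate D (- Min D)}"
  have "F \<subseteq> Pow (translate D (- Min D))" by (auto simp: F_def)
  then have "finite F" by (rule finite_subset) (simp add: translate_def fin[OF D(1)])
  moreover have "F \<noteq> {}" using zero by (auto simp: F_def)
  ultimately obtain E where E: "E \<in> F" and min: "\<forall>E'\<in>F. E' \<subseteq> E \<longrightarrow> E = E'"
    using finite_has_minimal[of F] by metis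
  have "\<not> E' \<subset> E" if "E' \<in> ?Z" for E'
  proof
    assume "E' \<subset> E"
    moreover have "E' \<in> F" using that E \<open>E' \<subset> E\<close> by (auto simp: F_def)
    ultimately show False using min by blast
  qed
  then have "E \<in> W_prime S" using E by (simp add: W_prime_def F_def)
  moreover have "E \<subseteq> translate D (- Min D)" using E by (simp add: F_def)
  ultimately show ?thesis by (rule that)
qed

text \<open>A monochromatic translate of a set contains one of each minimal set below it; conversely
  every member of \<open>W_prime S\<close> is itself a translate of a member of
  \<open>W_star S\<close>.\<close>

lemma translate_ramsey_W_prime_iff:
  assumes S: "1 \<le> d" "S \<subseteq> cube d" "S \<noteq> {}"
  shows "translate_ramsey t (W_star S) \<longleftrightarrow> translate_ramsey t (W_prime S)"
proof
  assume star: "translate_ramsey t (W_star S)"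
  show "translate_ramsey t (W_prime S)" unfolding translate_ramsey_def
  proof (intro allI impI)
    fix c :: "int \<Rightarrow> nat" assume "range c \<subseteq> {1..t}"
    then obtain D j where D: "D \<in> W_star S"
      and mono: "\<forall>x\<in>translate D j. \<forall>y\<in>translate D j. c x = c y"
      using star unfolding translate_ramsey_def by metis
    obtain E b where E: "E \<in> W_prime S" "E \<subseteq> translate D b"
      using W_prime_below[OF finite_W_star_member[OF S(1,2)] D] W_star_nonempty_member[OF S(3) D]
      by metis
    have "translate E (j - b) \<subseteq> translate (translate D b) (j - b)"
      using E(2) by (auto simp: translate_def)
    then have "translate E (j - b) \<subseteq> translate D j" by (simp add: translate_translate)
    then show "\<exists>D\<in>W_prime S. \<exists>j. \<forall>x\<in>translate D j. \<forall>y\<in>translate D j. c x = c y"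
      using E(1) mono by (meson subsetD)
  qed
next
  assume prime: "translate_ramsey t (W_prime S)"
  show "translate_ramsey t (W_star S)" unfolding translate_ramsey_def
  proof (intro allI impI)
    fix c :: "int \<Rightarrow> nat" assume "range c \<subseteq> {1..t}"
    then obtain E j where E: "E \<in> W_prime S"
      and mono: "\<forall>x\<in>translate E j. \<forall>y\<in>translate E j. c x = c y"
      using prime unfolding translate_ramsey_def by metis
    obtain D b where "D \<in> W_star S" "E = translate D b"
      using E by (auto simp: W_prime_def zero_based_translates_def)
    then show "\<exists>D\<in>W_star S. \<exists>j. \<forall>x\<in>translate D j. \<forall>y\<in>translate D j. c x = c y"
      using mono translate_translate by metis
  qed
qed

text \<open>The empty set is set apart in the second equivalence: \<open>W_star {}\<close> has the
  empty set as a member, which is trivially monochromatic, whereas \<open>W_prime {}\<close> is the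
  empty family and so not translate-Ramsey for \<open>t \<ge> 2\<close>.\<close>

theorem lemma5:
  fixes t d :: nat and S :: "nat set set"
  assumes "2 \<le> t" and "1 \<le> d" and "S \<subseteq> cube d"
  shows "(cube_ramsey t d S \<longleftrightarrow> translate_ramsey t (W_star S)) \<and>
         (S \<noteq> {} \<longrightarrow> (translate_ramsey t (W_star S) \<longleftrightarrow> translate_ramsey t (W_prime S)))"
  using cube_ramsey_imp_translate_ramsey[OF assms(2,3)]
    translate_ramsey_imp_cube_ramsey[OF _ assms(2,3)]
    translate_ramsey_W_prime_iff[OF assms(2,3)] assms(1)
  by auto

end
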